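(* Let $G_1,G_2$ be matroids on ground sets $E_1,E_2$ with $E_1\cap E_2=F$ a flat of rank $p$ in both, modular in $G_1$. Let $\mathcal A_1$ in $\mathbb C^r$ and $\mathcal A_2$ in $\mathbb C^s$ be arrangements realizing $G_1,G_2$, such that the element $X_1\in L(\mathcal A_1)$ corresponding to $F$ is $X_1=\mathbb C^{r-p}\times\{0\}$ (so the hyperplanes of $(\mathcal A_1)_{X_1}$ have defining forms involving only the last $p$ coordinates of $\mathbb C^r$), and the hyperplanes of $(\mathcal A_2)_{X_2}$, where $X_2\in L(\mathcal A_2)$ corresponds to $F$, are defined by the same forms written in the first $p$ coordinates of $\mathbb C^s$. Let $\ell=r+s-p$, write $\mathbb C^\ell=\mathbb C^{r-p}\times\mathbb C^p\times\mathbb C^{s-p}$, pull back $\mathcal A_1$ to $\mathbb C^r\times\mathbb C^{s-p}$ and $\mathcal A_2$ to $\mathbb C^{r-p}\times\mathbb C^s$ via coordinate projections, and let $\mathcal A=(\mathcal A_1\setminus(\mathcal A_1)_{X_1})\cup\mathcal A_2$ in $\mathbb C^\ell$. Regard $(\mathcal A_1)_{X_1}$ as an arrangement in $\mathbb C^p\cong\mathbb C^r/X_1\cong\mathbb C^s/X_2$. Let $M(\mathcal A_1)\to M((\mathcal A_1)_{X_1})$ be the restriction of the projection $\pi_1:\mathbb C^r\to\mathbb C^p$ onto the last $p$ coordinates, $M(\mathcal A)\to M(\mathcal A_2)$ the restriction of the projection $\mathbb C^\ell\to\mathbb C^s$ onto the last $s$ coordinates, and $M(\mathcal A_2)\to M((\mathcal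 A_1)_{X_1})$ the restriction of the projection $\pi_2:\mathbb C^s\to\mathbb C^p$ onto the first $p$ coordinates. Then the square formed by these maps together with the map $M(\mathcal A)\to M(\mathcal A_1)$ induced by projection onto the first $r$ coordinates is a pullback diagram; that is, the fiber bundle $M(\mathcal A)\to M(\mathcal A_2)$ is the pullback of the bundle $M(\mathcal A_1)\to M((\mathcal A_1)_{X_1})$ along $M(\mathcal A_2)\to M((\mathcal A_1)_{X_1})$.
   Context: For an arrangement $\mathcal B$ in $V$, $M(\mathcal B)=V\setminus\bigcup\mathcal B$, and $L(\mathcal B)$ is its intersection lattice (intersections of hyperplanes, ordered by reverse inclusion); $\mathcal B_X=\{H\in\mathcal B: H\supseteq X\}$. An arrangement realizes a matroid if its underlying matroid (sets $\mathcal C$ dependent iff $\operatorname{codim}\bigcap\mathcal C<|\mathcal C|$) is that matroid; flats correspond to elements $X$ of the lattice via $X\mapsto\mathcal B_X$. A flat $F$ of a matroid is modular if $r(F)+r(Y)=r(F\vee Y)+r(F\wedge Y)$ for all flats $Y$. The generalized parallel connection $P_F(G_1,G_2)$ is the matroid on $E_1\cup E_2$ whose flats are the sets $Y$ with $Y\cap E_i$ a flat of $G_i$ for $i=1,2$; the arrangement $\mathcal A$ realizes $P_F(G_1,G_2)$, and the projections to $M(\mathcal A_2)$ and $M((\mathcal A_1)_{X_1})$ are fiber bundles. *)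

theory Defs
  imports "HOL-Analysis.Analysis" "HOL-Library.Function_Algebras"
begin

section \<open>Matroids\<close>

definition matroid :: "'e set \<Rightarrow> 'e set set \<Rightarrow> bool" where
  "matroid E I \<longleftrightarrow>
     finite E \<and> I \<subseteq> Pow E \<and> {} \<in> I \<and>
     (\<forall>S\<in>I. \<forall>T\<subseteq>S. T \<in> I) \<and>
     (\<forall>S\<in>I. \<forall>T\<in>I. card S < card T \<longrightarrow> (\<exists>e\<in>T - S. insert e S \<in> I))"

definition mrank :: "'e set set \<Rightarrow> 'e set \<Rightarrow> nat" where
  "mrank I S = Max (card ` {T \<in> I. T \<subseteq> S})"

definition mflat :: "'e set \<Rightarrow> 'e set set \<Rightarrow> 'e set \<Rightarrow> bool" where
  "mflat E I Y \<longleftrightarrow> Y \<subseteq> E \<and> (\<forall>e\<in>E - Y. mrank I Y < mrank I (insert e Y))"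

definition mclosure :: "'e set \<Rightarrow> 'e set set \<Rightarrow> 'e set \<Rightarrow> 'e set" where
  "mclosure E I S = {e \<in> E. mrank I (insert e S) = mrank I S}"

text \<open>In the lattice of flats the join is the closure of the union, the meet is the
  intersection.\<close>

definition modular_flat :: "'e set \<Rightarrow> 'e set set \<Rightarrow> 'e set \<Rightarrow> bool" where
  "modular_flat E I F \<longleftrightarrow> mflat E I F \<and>
     (\<forall>Y. mflat E I Y \<longrightarrow>
        mrank I F + mrank I Y = mrank I (mclosure E I (F \<union> Y)) + mrank I (F \<inter> Y))"

section \<open>Coordinate spaces\<close>

text \<open>As for the library's \<^const>\<open>Euclidean_space\<close>, a vector of \<open>\<complex>\<^sup>n\<close> is a sequence
  vanishing from index \<open>n\<close> on; \<open>n = 0\<close> is allowed.  Coordinates are numbered from \<open>0\<close>.\<close>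

definition cspace :: "nat \<Rightarrow> (nat \<Rightarrow> complex) set" where
  "cspace n = {x. \<forall>i\<ge>n. x i = 0}"

definition cspace_top :: "nat \<Rightarrow> (nat \<Rightarrow> complex) topology" where
  "cspace_top n = subtopology (product_topology (\<lambda>_. euclidean) UNIV) (cspace n)"

definition coords :: "nat \<Rightarrow> nat \<Rightarrow> (nat \<Rightarrow> complex) \<Rightarrow> (nat \<Rightarrow> complex)" where
  "coords k n x = (\<lambda>i. if i < n then x (k + i) else 0)"

definition lform :: "nat \<Rightarrow> (nat \<Rightarrow> complex) \<Rightarrow> (nat \<Rightarrow> complex) \<Rightarrow> complex" where
  "lform n a x = (\<Sum>i<n. a i * x i)"

global_interpretation cvec: vector_space "\<lambda>(c::complex) (x::nat \<Rightarrow> complex) i. c * x i"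
  by unfold_locales (auto simp: fun_eq_iff algebra_simps)

abbreviation codim :: "nat \<Rightarrow> (nat \<Rightarrow> complex) set \<Rightarrow> nat" where
  "codim n X \<equiv> n - cvec.dim X"

section \<open>Hyperplane arrangements\<close>

definition hyperplane :: "nat \<Rightarrow> (nat \<Rightarrow> complex) set \<Rightarrow> bool" where
  "hyperplane n H \<longleftrightarrow> (\<exists>a. (\<exists>i<n. a i \<noteq> 0) \<and> H = {x \<in> cspace n. lform n a x = 0})"

definition arrangement :: "nat \<Rightarrow> (nat \<Rightarrow> complex) set set \<Rightarrow> bool" where
  "arrangement n B \<longleftrightarrow> finite B \<and> (\<forall>H\<in>B. hyperplane n H)"

text \<open>Intersections are taken inside \<open>\<complex>\<^sup>n\<close>, so the empty one is \<open>\<complex>\<^sup>n\<close> itself.\<close>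

definition meet :: "nat \<Rightarrow> (nat \<Rightarrow> complex) set set \<Rightarrow> (nat \<Rightarrow> complex) set" where
  "meet n C = cspace n \<inter> \<Inter>C"

definition intersection_lattice ::
    "nat \<Rightarrow> (nat \<Rightarrow> complex) set set \<Rightarrow> (nat \<Rightarrow> complex) set set" where
  "intersection_lattice n B = meet n ` Pow B"

definition localization ::
    "(nat \<Rightarrow> complex) set set \<Rightarrow> (nat \<Rightarrow> complex) set \<Rightarrow> (nat \<Rightarrow> complex) set set" where
  "localization B X = {H \<in> B. X \<subseteq> H}"

text \<open>The ground set of the matroid labels the hyperplanes: \<open>h\<close> is the bijection
  from labels to hyperplanes.\<close>

definition realizes ::
    "nat \<Rightarrow> (nat \<Rightarrow> complex) set set \<Rightarrow> ('e \<Rightarrow> (nat \<Rightarrow> complex) set) \<Rightarrow> 'e set \<Rightarrow> 'e set set \<Rightarrow> bool"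
  where
  "realizes n B h E I \<longleftrightarrow> arrangement n B \<and> bij_betw h E B \<and>
     (\<forall>C\<subseteq>E. C \<notin> I \<longleftrightarrow> codim n (meet n (h ` C)) < card C)"

definition pullback_arr ::
    "nat \<Rightarrow> ((nat \<Rightarrow> complex) \<Rightarrow> (nat \<Rightarrow> complex)) \<Rightarrow> (nat \<Rightarrow> complex) set set
      \<Rightarrow> (nat \<Rightarrow> complex) set set" where
  "pullback_arr n f B = (\<lambda>H. {x \<in> cspace n. f x \<in> H}) ` B"

definition arr_complement :: "nat \<Rightarrow> (nat \<Rightarrow> complex) set set \<Rightarrow> (nat \<Rightarrow> complex) topology" where
  "arr_complement n B = subtopology (cspace_top n) (cspace n - \<Union>B)"

text \<open>The arrangement \<open>(A\<^sub>1 - (A\<^sub>1)\<^sub>X) \<union> A\<^sub>2\<close> in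
  \<open>\<complex>\<^sup>r\<^sup>+\<^sup>s\<^sup>-\<^sup>p\<close>, both parts pulled back along the coordinate projections.\<close>

definition parallel_arr ::
    "nat \<Rightarrow> nat \<Rightarrow> nat \<Rightarrow> (nat \<Rightarrow> complex) set set \<Rightarrow> (nat \<Rightarrow> complex) set
      \<Rightarrow> (nat \<Rightarrow> complex) set set \<Rightarrow> (nat \<Rightarrow> complex) set set" where
  "parallel_arr r s p A1 X1 A2 =
     pullback_arr (r + s - p) (coords 0 r) (A1 - localization A1 X1) \<union>
     pullback_arr (r + s - p) (coords (r - p) s) A2"

text \<open>\<open>(A\<^sub>1)\<^sub>X\<close> regarded as an arrangement in \<open>\<complex>\<^sup>p\<close>, namely in the quotient of
  \<open>\<complex>\<^sup>r\<close> by \<open>X\<close>, which the last \<open>p\<close> coordinates identify with \<open>\<complex>\<^sup>p\<close>.\<close>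

definition quotient_arr ::
    "nat \<Rightarrow> nat \<Rightarrow> (nat \<Rightarrow> complex) set set \<Rightarrow> (nat \<Rightarrow> complex) set \<Rightarrow> (nat \<Rightarrow> complex) set set"
  where
  "quotient_arr r p A1 X1 = (\<lambda>H. coords (r - p) p ` H) ` localization A1 X1"

section \<open>Pullbacks and fiber bundles\<close>

text \<open>The square with \<open>t : P \<rightarrow> X\<close>, \<open>q : P \<rightarrow> Y\<close>, \<open>f : X \<rightarrow> Z\<close>, \<open>g : Y \<rightarrow> Z\<close>.\<close>

definition commutative_square ::
    "'p topology \<Rightarrow> 'x topology \<Rightarrow> 'y topology \<Rightarrow> 'z topology
      \<Rightarrow> ('p \<Rightarrow> 'x) \<Rightarrow> ('p \<Rightarrow> 'y) \<Rightarrow> ('x \<Rightarrow> 'z) \<Rightarrow> ('y \<Rightarrow> 'z) \<Rightarrow> bool" where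
  "commutative_square P X Y Z t q f g \<longleftrightarrow>
     continuous_map P X t \<and> continuous_map P Y q \<and> continuous_map X Z f \<and> continuous_map Y Z g \<and>
     (\<forall>w\<in>topspace P. f (t w) = g (q w))"

text \<open>The universal property, for test spaces \<open>W\<close> with points in the type \<open>'w\<close>.  Since HOL
  cannot quantify over types inside a definition, that type is a parameter, to be left arbitrary.
  Maps out of \<open>W\<close> are made unique as functions by requiring extensionality.\<close>

definition pullback_square ::
    "'w itself \<Rightarrow> 'p topology \<Rightarrow> 'x topology \<Rightarrow> 'y topology \<Rightarrow> 'z topology
      \<Rightarrow> ('p \<Rightarrow> 'x) \<Rightarrow> ('p \<Rightarrow> 'y) \<Rightarrow> ('x \<Rightarrow> 'z) \<Rightarrow> ('y \<Rightarrow> 'z) \<Rightarrow> bool" where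
  "pullback_square TW P X Y Z t q f g \<longleftrightarrow>
     commutative_square P X Y Z t q f g \<and>
     (\<forall>(W :: 'w topology) u v.
        continuous_map W X u \<and> continuous_map W Y v \<and> (\<forall>w\<in>topspace W. f (u w) = g (v w)) \<longrightarrow>
        (\<exists>!k. k \<in> extensional (topspace W) \<and> continuous_map W P k \<and>
              (\<forall>w\<in>topspace W. t (k w) = u w \<and> q (k w) = v w)))"

text \<open>The total space over \<open>Y\<close> of the pullback of \<open>f : X \<rightarrow> Z\<close> along \<open>g : Y \<rightarrow> Z\<close>; the
  bundle projection is \<^const>\<open>fst\<close>.\<close>

definition pullback_total ::
    "'y topology \<Rightarrow> ('y \<Rightarrow> 'z) \<Rightarrow> 'x topology \<Rightarrow> ('x \<Rightarrow> 'z) \<Rightarrow> ('y \<times> 'x) topology" where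
  "pullback_total Y g X f = subtopology (prod_topology Y X) {(y, x). g y = f x}"

text \<open>\<open>q : P \<rightarrow> Y\<close> is the pullback of \<open>f : X \<rightarrow> Z\<close> along \<open>g : Y \<rightarrow> Z\<close>, with bundle
  map \<open>t : P \<rightarrow> X\<close>.\<close>

definition is_pullback_bundle ::
    "'p topology \<Rightarrow> 'x topology \<Rightarrow> 'y topology \<Rightarrow> 'z topology
      \<Rightarrow> ('p \<Rightarrow> 'x) \<Rightarrow> ('p \<Rightarrow> 'y) \<Rightarrow> ('x \<Rightarrow> 'z) \<Rightarrow> ('y \<Rightarrow> 'z) \<Rightarrow> bool" where
  "is_pullback_bundle P X Y Z t q f g \<longleftrightarrow>
     commutative_square P X Y Z t q f g \<and>
     homeomorphic_map P (pullback_total Y g X f) (\<lambda>w. (q w, t w))"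

definition fiber_bundle ::
    "'x topology \<Rightarrow> 'z topology \<Rightarrow> ('x \<Rightarrow> 'z) \<Rightarrow> 'f topology \<Rightarrow> bool" where
  "fiber_bundle X Z f \<Phi> \<longleftrightarrow> continuous_map X Z f \<and>
     (\<forall>z\<in>topspace Z. \<exists>U \<phi>. openin Z U \<and> z \<in> U \<and>
        homeomorphic_map (subtopology X {x \<in> topspace X. f x \<in> U})
                         (prod_topology (subtopology Z U) \<Phi>) \<phi> \<and>
        (\<forall>x\<in>topspace X. f x \<in> U \<longrightarrow> fst (\<phi> x) = f x))"

end

theory Submission
  imports Defs
begin

text \<open>A point of \<open>\<complex>\<^sup>r\<^sup>+\<^sup>s\<^sup>-\<^sup>p\<close> is the same as a pair of points of \<open>\<complex>\<^sup>r\<close> and \<open>\<complex>\<^sup>s\<close> that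
  agree in the \<open>p\<close> shared coordinates, and gluing such a pair is continuous.  A hyperplane of
  \<open>A\<^sub>1\<close> containing \<open>X\<^sub>1\<close> pulls back to the same hyperplane as its counterpart in \<open>A\<^sub>2\<close>, so
  removing these from \<open>A\<^sub>1\<close> does not change the union: a point avoids the parallel connection
  exactly if its two projections avoid \<open>A\<^sub>1\<close> and \<open>A\<^sub>2\<close>.  The complement is therefore the
  topological fibre product, and local trivializations pull back.\<close>

section \<open>Topological pullbacks\<close>

lemma continuous_map_pullback_total_iff:
  "continuous_map W (pullback_total Y g X f) (\<lambda>w. (v w, u w)) \<longleftrightarrow>
     continuous_map W Y v \<and> continuous_map W X u \<and> (\<forall>w\<in>topspace W. g (v w) = f (u w))"
  by (auto simp: pullback_total_def continuous_map_in_subtopology continuous_map_paired)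

lemma topspace_pullback_total:
  "topspace (pullback_total Y g X f) = {(y, x). y \<in> topspace Y \<and> x \<in> topspace X \<and> g y = f x}"
  by (auto simp: pullback_total_def)

lemma continuous_map_pullback_total_fst: "continuous_map (pullback_total Y g X f) Y fst"
  and continuous_map_pullback_total_snd: "continuous_map (pullback_total Y g X f) X snd"
  by (auto simp: pullback_total_def continuous_map_fst continuous_map_snd
      intro: continuous_map_from_subtopology)

lemma pullback_bundle_inverseE:
  assumes "is_pullback_bundle P X Y Z t q f g"
  obtains k where "homeomorphic_maps P (pullback_total Y g X f) (\<lambda>w. (q w, t w)) k"
  using assms by (auto simp: is_pullback_bundle_def homeomorphic_map_maps)

text \<open>A compatible pair \<open>u\<close>, \<open>v\<close> is a single map into the explicit
  fibre product. Composing it with the inverse \<open>k\<close> of the homeomorphism gives the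
  mediating map.\<close>

lemma is_pullback_bundle_imp_pullback_square:
  assumes B: "is_pullback_bundle P X Y Z t q f g"
  shows "pullback_square TYPE('w) P X Y Z t q f g"
  unfolding pullback_square_def
proof (intro conjI allI impI)
  show "commutative_square P X Y Z t q f g"
    using B by (simp add: is_pullback_bundle_def)
  fix W :: "'w topology" and u v
  assume uv: "continuous_map W X u \<and> continuous_map W Y v \<and> (\<forall>w\<in>topspace W. f (u w) = g (v w))"
  obtain k where k: "homeomorphic_maps P (pullback_total Y g X f) (\<lambda>w. (q w, t w)) k"
    using B by (rule pullback_bundle_inverseE)
  have uv': "continuous_map W (pullback_total Y g X f) (\<lambda>w. (v w, u w))"
    using uv by (simp add: continuous_map_pullback_total_iff)
  have mem: "(v w, u w) \<in> topspace (pullback_total Y g X f)" if "w \<in> topspace W" for w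
    using that uv' by (auto simp: continuous_map_def)
  \<comment> \<open>Restricting to the points of \<open>W\<close> makes the mediating map
    extensional, so that uniqueness is an equality of functions.\<close>
  define m where "m = restrict (\<lambda>w. k (v w, u w)) (topspace W)"
  show "\<exists>!k. k \<in> extensional (topspace W) \<and> continuous_map W P k \<and>
          (\<forall>w\<in>topspace W. t (k w) = u w \<and> q (k w) = v w)"
  proof (intro ex1I conjI)
    show "m \<in> extensional (topspace W)"
      by (simp add: m_def)
    have "continuous_map W P (k \<circ> (\<lambda>w. (v w, u w)))"
      using k uv' by (auto simp: homeomorphic_maps_def intro: continuous_map_compose)
    then show "continuous_map W P m"
      by (rule continuous_map_eq) (simp add: m_def)
    show "\<forall>w\<in>topspace W. t (m w) = u w \<and> q (m w) = v w"
      using k mem by (auto simp: homeomorphic_maps_def m_def)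
  next
    fix n
    assume n: "n \<in> extensional (topspace W) \<and> continuous_map W P n \<and>
      (\<forall>w\<in>topspace W. t (n w) = u w \<and> q (n w) = v w)"
    show "n = m"
    proof (rule extensionalityI)
      show "n \<in> extensional (topspace W)" "m \<in> extensional (topspace W)"
        using n by (auto simp: m_def)
      fix w assume w: "w \<in> topspace W"
      then have "n w \<in> topspace P"
        using n by (auto simp: continuous_map_def)
      \<comment> \<open>Uniqueness: through \<open>k\<close>, a point of \<open>P\<close> is
        determined by its images under \<open>q\<close> and \<open>t\<close>, and these are
        prescribed.\<close>
      then have "n w = k (q (n w), t (n w))"
        using k by (simp add: homeomorphic_maps_def)
      then show "n w = m w"
        using n w by (simp add: m_def)
    qed
  qed
qed

section \<open>Base change of local trivializations\<close>

text \<open>A trivialization \<phi> of \<open>f\<close> over \<open>U\<close> induces one of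
  \<open>q\<close> over the preimage \<open>V\<close> of \<open>U\<close> under \<open>g\<close>:
  the base point is \<open>q w\<close>, and the fibre coordinate is that of \<open>t w\<close> under
  \<phi>. Hence the fibre \<Phi> is unchanged.\<close>

lemma fiber_bundle_pullback:
  assumes B: "is_pullback_bundle P X Y Z t q f g" and fib: "fiber_bundle X Z f \<Phi>"
  shows "fiber_bundle P Y q \<Phi>"
  unfolding fiber_bundle_def
proof (intro conjI ballI)
  have sq: "continuous_map P X t" "continuous_map P Y q" "continuous_map X Z f"
    "continuous_map Y Z g" "\<And>w. w \<in> topspace P \<Longrightarrow> f (t w) = g (q w)"
    using B by (auto simp: is_pullback_bundle_def commutative_square_def)
  show "continuous_map P Y q" by fact
  obtain k where k: "homeomorphic_maps P (pullback_total Y g X f) (\<lambda>w. (q w, t w)) k"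
    using B by (rule pullback_bundle_inverseE)
  then have kc: "continuous_map (pullback_total Y g X f) P k"
    and kl: "\<And>w. w \<in> topspace P \<Longrightarrow> k (q w, t w) = w"
    and kr: "\<And>y x. y \<in> topspace Y \<Longrightarrow> x \<in> topspace X \<Longrightarrow> g y = f x
      \<Longrightarrow> q (k (y, x)) = y \<and> t (k (y, x)) = x"
    by (auto simp: homeomorphic_maps_def topspace_pullback_total)
  fix y assume "y \<in> topspace Y"
  then have "g y \<in> topspace Z"
    using sq(4) by (auto simp: continuous_map_def)
  then obtain U \<phi> where U: "openin Z U" "g y \<in> U"
    and "homeomorphic_map (subtopology X {x \<in> topspace X. f x \<in> U})
           (prod_topology (subtopology Z U) \<Phi>) \<phi>"
    and fst\<phi>: "\<And>x. x \<in> topspace X \<Longrightarrow> f x \<in> U \<Longrightarrow> fst (\<phi> x) = f x"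
    using fib unfolding fiber_bundle_def by metis
  then obtain \<theta> where \<theta>: "homeomorphic_maps (subtopology X {x \<in> topspace X. f x \<in> U})
           (prod_topology (subtopology Z U) \<Phi>) \<phi> \<theta>"
    by (auto simp: homeomorphic_map_maps)
  let ?XU = "subtopology X {x \<in> topspace X. f x \<in> U}"
  define V where "V = {y \<in> topspace Y. g y \<in> U}"
  let ?PV = "subtopology P {w \<in> topspace P. q w \<in> V}"
  let ?YF = "prod_topology (subtopology Y V) \<Phi>"
  define \<psi> where "\<psi> = (\<lambda>w. (q w, snd (\<phi> (t w))))"
  \<comment> \<open>The inverse of \<psi>: \<theta> supplies the point of \<open>X\<close> over
    \<open>g y\<close> with fibre coordinate \<open>b\<close>, and \<open>k\<close> combines it with
    \<open>y\<close> into a point of \<open>P\<close>.\<close>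
  define \<xi> where "\<xi> = (\<lambda>(y, b). k (y, \<theta> (g y, b)))"
  have \<phi>c: "continuous_map ?XU (prod_topology (subtopology Z U) \<Phi>) \<phi>"
    and \<theta>c: "continuous_map (prod_topology (subtopology Z U) \<Phi>) ?XU \<theta>"
    and \<theta>l: "\<And>x. x \<in> topspace X \<Longrightarrow> f x \<in> U \<Longrightarrow> \<theta> (\<phi> x) = x"
    and \<theta>r: "\<And>z b. z \<in> U \<Longrightarrow> b \<in> topspace \<Phi> \<Longrightarrow> \<phi> (\<theta> (z, b)) = (z, b)"
    using \<theta> openin_subset[OF U(1)] by (auto simp: homeomorphic_maps_def)
  \<comment> \<open>The point \<open>\<theta> (z, b)\<close> lies over \<open>z\<close> because
    \<phi> respects base points and sends it back to \<open>(z, b)\<close>.\<close>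
  have \<theta>mem: "\<theta> (z, b) \<in> topspace X" "f (\<theta> (z, b)) = z" if "z \<in> U" "b \<in> topspace \<Phi>" for z b
  proof -
    have "(z, b) \<in> topspace (prod_topology (subtopology Z U) \<Phi>)"
      using that openin_subset[OF U(1)] by auto
    then have "\<theta> (z, b) \<in> topspace ?XU"
      using \<theta>c by (blast dest: continuous_map_funspace)
    then show "\<theta> (z, b) \<in> topspace X" "f (\<theta> (z, b)) = z"
      using fst\<phi>[of "\<theta> (z, b)"] \<theta>r[OF that] by auto
  qed
  have V: "openin Y V"
    unfolding V_def using sq(4) U(1) by (rule openin_continuous_map_preimage)
  have qV: "g (q w) \<in> U \<and> t w \<in> topspace X \<and> f (t w) = g (q w) \<and> q w \<in> topspace Y"
    if "w \<in> topspace P" "q w \<in> V" for w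
    using that sq by (auto simp: V_def continuous_map_def)
  \<comment> \<open>Over \<open>V\<close> the map \<open>t\<close> lands in the trivialized part of
    \<open>X\<close>, since \<open>f (t w) = g (q w)\<close> lies in \<open>U\<close>; this allows
    \<phi> to be applied after it.\<close>
  have "continuous_map ?PV ?XU t"
    using sq(1) qV by (auto simp: continuous_map_in_subtopology intro: continuous_map_from_subtopology)
  then have "continuous_map ?PV \<Phi> (snd \<circ> (\<phi> \<circ> t))"
    by (rule continuous_map_compose[OF continuous_map_compose[OF _ \<phi>c] continuous_map_snd])
  then have \<psi>c: "continuous_map ?PV ?YF \<psi>"
    using sq(2) by (auto simp: \<psi>_def o_def continuous_map_paired continuous_map_in_subtopology
        intro: continuous_map_from_subtopology)
  have fstV: "continuous_map ?YF Y fst"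
    using continuous_map_fst[of "subtopology Y V" \<Phi>] by (auto simp: continuous_map_in_subtopology)
  have "continuous_map ?YF Z (g \<circ> fst)"
    by (rule continuous_map_compose[OF fstV sq(4)])
  then have "continuous_map ?YF (prod_topology (subtopology Z U) \<Phi>) (\<lambda>(y, b). (g y, b))"
    by (auto simp: case_prod_unfold continuous_map_paired continuous_map_in_subtopology
        continuous_map_snd o_def V_def)
  then have "continuous_map ?YF ?XU (\<theta> \<circ> (\<lambda>(y, b). (g y, b)))"
    using \<theta>c by (rule continuous_map_compose)
  \<comment> \<open>As \<open>\<theta> (g y, b)\<close> lies over \<open>g y\<close>, its pair with
    \<open>y\<close> is in the fibre product, where \<open>k\<close> is continuous.\<close>
  then have "continuous_map ?YF (pullback_total Y g X f) (\<lambda>a. (fst a, (\<theta> \<circ> (\<lambda>(y, b). (g y, b))) a))"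
    unfolding continuous_map_pullback_total_iff
  proof (intro conjI ballI fstV)
    assume "continuous_map ?YF ?XU (\<theta> \<circ> (\<lambda>(y, b). (g y, b)))"
    then show "continuous_map ?YF X (\<theta> \<circ> (\<lambda>(y, b). (g y, b)))"
      by (simp add: continuous_map_in_subtopology)
  next
    fix a assume "a \<in> topspace ?YF"
    then show "g (fst a) = f ((\<theta> \<circ> (\<lambda>(y, b). (g y, b))) a)"
      using \<theta>mem(2) by (auto simp: V_def)
  qed
  then have "continuous_map ?YF P (k \<circ> (\<lambda>a. (fst a, (\<theta> \<circ> (\<lambda>(y, b). (g y, b))) a)))"
    using kc by (rule continuous_map_compose)
  moreover have "(k \<circ> (\<lambda>a. (fst a, (\<theta> \<circ> (\<lambda>(y, b). (g y, b))) a))) = \<xi>"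
    by (auto simp: \<xi>_def)
  ultimately have \<xi>P: "continuous_map ?YF P \<xi>"
    by simp
  have q\<xi>: "q (\<xi> (y, b)) = y" "t (\<xi> (y, b)) = \<theta> (g y, b)" if "y \<in> V" "b \<in> topspace \<Phi>" for y b
    using that kr[of y "\<theta> (g y, b)"] \<theta>mem[of "g y" b] by (auto simp: \<xi>_def V_def)
  have \<xi>c: "continuous_map ?YF ?PV \<xi>"
    using \<xi>P q\<xi> continuous_map_funspace[OF \<xi>P] by (auto simp: continuous_map_in_subtopology)
  have "homeomorphic_maps ?PV ?YF \<psi> \<xi>"
    unfolding homeomorphic_maps_def
  proof (intro conjI ballI \<psi>c \<xi>c)
    fix w assume "w \<in> topspace ?PV"
    then have w: "w \<in> topspace P" "q w \<in> V" by auto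
    \<comment> \<open>\<psi> keeps only the fibre coordinate of \<open>\<phi> (t w)\<close>; the
      discarded base coordinate is recovered from \<open>q w\<close>.\<close>
    have "\<phi> (t w) = (g (q w), snd (\<phi> (t w)))"
      using fst\<phi>[of "t w"] qV[OF w] by (simp add: prod_eq_iff)
    then have "\<theta> (g (q w), snd (\<phi> (t w))) = t w"
      using \<theta>l[of "t w"] qV[OF w] by simp
    then show "\<xi> (\<psi> w) = w"
      using kl[OF w(1)] by (simp add: \<xi>_def \<psi>_def)
  next
    fix a assume "a \<in> topspace ?YF"
    then obtain y b where "a = (y, b)" "y \<in> V" "b \<in> topspace \<Phi>" by auto
    then show "\<psi> (\<xi> a) = a"
      using q\<xi>[of y b] \<theta>r[of "g y" b] by (simp add: \<psi>_def V_def)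
  qed
  then have "homeomorphic_map ?PV ?YF \<psi>"
    by (auto simp: homeomorphic_map_maps)
  then show "\<exists>U \<phi>. openin Y U \<and> y \<in> U \<and>
      homeomorphic_map (subtopology P {x \<in> topspace P. q x \<in> U})
        (prod_topology (subtopology Y U) \<Phi>) \<phi> \<and>
      (\<forall>x\<in>topspace P. q x \<in> U \<longrightarrow> fst (\<phi> x) = q x)"
    using V U(2) \<open>y \<in> topspace Y\<close> by (intro exI[of _ V] exI[of _ \<psi>]) (auto simp: V_def \<psi>_def)
qed

section \<open>Gluing coordinate vectors\<close>

text \<open>Used with \<open>d = r - p\<close>: the shared block occupies the positions from
  \<open>d\<close> to \<open>r - 1\<close> and is read from \<open>x\<close>, while from position
  \<open>r\<close> on the entries are those of \<open>y\<close> starting at index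
  \<open>p\<close>.\<close>

definition glue :: "nat \<Rightarrow> nat \<Rightarrow> (nat \<Rightarrow> complex) \<Rightarrow> (nat \<Rightarrow> complex) \<Rightarrow> nat \<Rightarrow> complex" where
  "glue d r x y = (\<lambda>i. if i < r then x i else y (i - d))"

lemma coords_in_cspace [simp]: "coords k n x \<in> cspace n"
  by (simp add: coords_def cspace_def)

text \<open>Both sides read the positions from \<open>r - p\<close> to \<open>r - 1\<close>, the
  shared block; this is the commutativity of the square.\<close>

lemma coords_coords_eq:
  assumes "p \<le> r" "p \<le> s"
  shows "coords (r - p) p (coords 0 r x) = coords 0 p (coords (r - p) s x)"
  using assms by (auto simp: coords_def fun_eq_iff)

lemma glue_coords:
  assumes "p \<le> r" "p \<le> s" "x \<in> cspace (r + s - p)"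
  shows "glue (r - p) r (coords 0 r x) (coords (r - p) s x) = x"
  using assms by (auto simp: glue_def coords_def cspace_def fun_eq_iff)

lemma glue_in_cspace:
  assumes "p \<le> r" "p \<le> s" "y \<in> cspace s"
  shows "glue (r - p) r x y \<in> cspace (r + s - p)"
  using assms by (auto simp: glue_def cspace_def)

lemma coords_glue_left:
  assumes "x \<in> cspace r"
  shows "coords 0 r (glue d r x y) = x"
  using assms by (auto simp: glue_def coords_def cspace_def fun_eq_iff)

text \<open>The first \<open>p\<close> entries of the result come from \<open>x\<close>, so
  agreement on the shared block is what turns them into those of \<open>y\<close>. Recovering
  \<open>x\<close> requires no such condition, because \<open>glue\<close> prefers \<open>x\<close>
  there.\<close>

lemma coords_glue_right:
  assumes "p \<le> r" "p \<le> s" "y \<in> cspace s" and eq: "coords (r - p) p x = coords 0 p y"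
  shows "coords (r - p) s (glue (r - p) r x y) = y"
proof
  fix i
  have "x (r - p + i) = y i" if "i < p"
    using fun_cong[OF eq, of i] that by (simp add: coords_def)
  then show "coords (r - p) s (glue (r - p) r x y) i = y i"
    using assms(1-3) by (auto simp: glue_def coords_def cspace_def)
qed

section \<open>Continuity of projections and gluing between complements\<close>

lemma arr_complement_eq:
  "arr_complement n B = subtopology (product_topology (\<lambda>_. euclidean) UNIV) (cspace n - \<Union>B)"
  by (simp add: arr_complement_def cspace_top_def subtopology_subtopology Int_absorb1)

lemma topspace_arr_complement [simp]: "topspace (arr_complement n B) = cspace n - \<Union>B"
  by (simp add: arr_complement_eq)

lemma continuous_map_arr_complement_iff:
  "continuous_map W (arr_complement n B) u \<longleftrightarrow>
     (\<forall>i. continuous_map W euclidean (\<lambda>w. u w i)) \<and> u \<in> topspace W \<rightarrow> cspace n - \<Union>B"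
  by (auto simp: arr_complement_eq continuous_map_in_subtopology continuous_map_componentwise_UNIV)

lemma continuous_map_arr_complement_coord:
  "continuous_map (arr_complement n B) euclidean (\<lambda>x. x i)"
  unfolding arr_complement_eq
  by (intro continuous_map_from_subtopology continuous_map_product_projection) simp

text \<open>Each entry of the image is a coordinate of the argument or constantly 0, so only
  avoidance of the target arrangement remains to be checked.\<close>

lemma continuous_map_coords:
  assumes "\<And>x. x \<in> cspace m - \<Union>B \<Longrightarrow> coords k n x \<notin> \<Union>C"
  shows "continuous_map (arr_complement m B) (arr_complement n C) (coords k n)"
  unfolding continuous_map_arr_complement_iff
proof (intro conjI allI)
  fix i
  show "continuous_map (arr_complement m B) euclidean (\<lambda>w. coords k n w i)"
    by (cases "i < n") (simp_all add: coords_def continuous_map_arr_complement_coord)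
qed (use assms in auto)

text \<open>Which of the two vectors an entry is read from depends only on its index, so every entry
  is a coordinate projection of one factor.\<close>

lemma continuous_map_glue:
  assumes "\<And>y x. y \<in> cspace s - \<Union>C \<Longrightarrow> x \<in> cspace r - \<Union>B \<Longrightarrow> g y = f x
    \<Longrightarrow> glue d r x y \<in> cspace n - \<Union>D"
  shows "continuous_map (pullback_total (arr_complement s C) g (arr_complement r B) f)
    (arr_complement n D) (\<lambda>(y, x). glue d r x y)"
  unfolding continuous_map_arr_complement_iff
proof (intro conjI allI)
  let ?T = "pullback_total (arr_complement s C) g (arr_complement r B) f"
  fix i
  have "continuous_map ?T euclidean ((\<lambda>x. x i) \<circ> snd)"
    by (rule continuous_map_compose[OF continuous_map_pullback_total_snd
          continuous_map_arr_complement_coord])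
  moreover have "continuous_map ?T euclidean ((\<lambda>y. y (i - d)) \<circ> fst)"
    by (rule continuous_map_compose[OF continuous_map_pullback_total_fst
          continuous_map_arr_complement_coord])
  ultimately show "continuous_map ?T euclidean (\<lambda>w. (case w of (y, x) \<Rightarrow> glue d r x y) i)"
    by (cases "i < r") (simp_all add: glue_def case_prod_unfold o_def)
next
  show "(\<lambda>(y, x). glue d r x y)
    \<in> topspace (pullback_total (arr_complement s C) g (arr_complement r B) f) \<rightarrow> cspace n - \<Union>D"
    using assms by (auto simp only: topspace_pullback_total topspace_arr_complement)
qed

section \<open>The parallel connection of arrangements\<close>

text \<open>The common defining forms enter here: a form in the shared coordinates takes the same
  value on both projections of \<open>x\<close>. If the first projection lies on a hyperplane
  removed from \<open>A1\<close>, the second therefore lies on its counterpart in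
  \<open>A2\<close>.\<close>

lemma parallel_arr_complement_iff:
  assumes "p \<le> r" "p \<le> s"
    and match: "\<forall>H\<in>localization A1 X1. \<exists>a.
       H = {x \<in> cspace r. lform p a (coords (r - p) p x) = 0} \<and>
       {x \<in> cspace s. lform p a (coords 0 p x) = 0} \<in> A2"
  shows "x \<in> cspace (r + s - p) - \<Union>(parallel_arr r s p A1 X1 A2) \<longleftrightarrow>
     x \<in> cspace (r + s - p) \<and> coords 0 r x \<notin> \<Union>A1 \<and> coords (r - p) s x \<notin> \<Union>A2"
proof -
  have loc: "coords (r - p) s x \<in> \<Union>A2" if H: "H \<in> localization A1 X1" "coords 0 r x \<in> H" for H
  proof -
    obtain a where a: "H = {x \<in> cspace r. lform p a (coords (r - p) p x) = 0}"
      "{x \<in> cspace s. lform p a (coords 0 p x) = 0} \<in> A2"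
      using bspec[OF match H(1)] by blast
    have "lform p a (coords 0 p (coords (r - p) s x)) = 0"
      using H(2) unfolding a(1) coords_coords_eq[OF assms(1,2), symmetric] by simp
    then show ?thesis
      by (intro UnionI[OF a(2)]) simp
  qed
  have "x \<in> \<Union>(parallel_arr r s p A1 X1 A2) \<longleftrightarrow>
      coords 0 r x \<in> \<Union>(A1 - localization A1 X1) \<or> coords (r - p) s x \<in> \<Union>A2"
    if "x \<in> cspace (r + s - p)"
    using that by (simp add: parallel_arr_def pullback_arr_def)
  moreover have "\<Union>A1 = \<Union>(A1 - localization A1 X1) \<union> \<Union>(localization A1 X1)"
    by (auto simp: localization_def)
  ultimately show ?thesis
    using loc by (simp only: Diff_iff Un_iff) (metis UnionE)
qed

text \<open>Having equal images in the base means agreeing on the shared block, which is exactly the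
  condition for gluing. So gluing inverts the pair of projections.\<close>

lemma is_pullback_bundle_parallel_arr:
  assumes le: "p \<le> r" "p \<le> s"
    and match: "\<forall>H\<in>localization A1 X1. \<exists>a.
       H = {x \<in> cspace r. lform p a (coords (r - p) p x) = 0} \<and>
       {x \<in> cspace s. lform p a (coords 0 p x) = 0} \<in> A2"
  shows "is_pullback_bundle
    (arr_complement (r + s - p) (parallel_arr r s p A1 X1 A2))
    (arr_complement r A1) (arr_complement s A2) (arr_complement p (quotient_arr r p A1 X1))
    (coords 0 r) (coords (r - p) s) (coords (r - p) p) (coords 0 p)"
    (is "is_pullback_bundle ?P ?X ?Y ?Z ?t ?q ?f ?g")
proof -
  have mem: "x \<in> cspace (r + s - p) - \<Union>(parallel_arr r s p A1 X1 A2) \<longleftrightarrow>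
     x \<in> cspace (r + s - p) \<and> coords 0 r x \<notin> \<Union>A1 \<and> coords (r - p) s x \<notin> \<Union>A2" for x
    using match by (rule parallel_arr_complement_iff[OF le])
  have t: "continuous_map ?P ?X ?t" and q: "continuous_map ?P ?Y ?q"
    by (rule continuous_map_coords, simp only: mem not_False_eq_True)+
  have f: "continuous_map ?X ?Z ?f"
  proof (rule continuous_map_coords, rule notI)
    fix x assume x: "x \<in> cspace r - \<Union>A1" and "?f x \<in> \<Union>(quotient_arr r p A1 X1)"
    then obtain H x' where H: "H \<in> localization A1 X1" "x' \<in> H" "?f x = ?f x'"
      by (auto simp: quotient_arr_def)
    obtain a where a: "H = {x \<in> cspace r. lform p a (?f x) = 0}"
      using bspec[OF match H(1)] by blast
    \<comment> \<open>The equation of \<open>H\<close> involves only the last \<open>p\<close>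
      coordinates, so \<open>H\<close> contains every vector of \<open>cspace r\<close> with the
      same image as \<open>x'\<close>.\<close>
    have "x \<in> H"
      using H(2) x H(3) by (simp add: a)
    then show False
      using x H(1) by (auto simp: localization_def)
  qed
  have g: "continuous_map ?Y ?Z ?g"
  proof (rule continuous_map_coords, rule notI)
    fix y assume y: "y \<in> cspace s - \<Union>A2" and "?g y \<in> \<Union>(quotient_arr r p A1 X1)"
    then obtain H x' where H: "H \<in> localization A1 X1" "x' \<in> H" "?g y = ?f x'"
      by (auto simp: quotient_arr_def)
    obtain a where a: "H = {x \<in> cspace r. lform p a (?f x) = 0}"
      "{x \<in> cspace s. lform p a (?g x) = 0} \<in> A2"
      using bspec[OF match H(1)] by blast
    \<comment> \<open>The first \<open>p\<close> coordinates of \<open>y\<close> are the last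
      \<open>p\<close> of \<open>x'\<close>, on which the form \<open>a\<close> vanishes; this puts
      \<open>y\<close> on the counterpart of \<open>H\<close> in \<open>A2\<close>.\<close>
    have "y \<in> {x \<in> cspace s. lform p a (?g x) = 0}"
      using H(2) y H(3) by (simp add: a(1))
    then show False
      using a(2) y by blast
  qed
  have sq: "commutative_square ?P ?X ?Y ?Z ?t ?q ?f ?g"
    using t q f g coords_coords_eq[OF le] by (simp add: commutative_square_def)
  have "homeomorphic_maps ?P (pullback_total ?Y ?g ?X ?f) (\<lambda>w. (?q w, ?t w))
          (\<lambda>(y, x). glue (r - p) r x y)"
    unfolding homeomorphic_maps_def continuous_map_pullback_total_iff
  proof (intro conjI ballI t q)
    show "continuous_map (pullback_total ?Y ?g ?X ?f) ?P (\<lambda>(y, x). glue (r - p) r x y)"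
    proof (rule continuous_map_glue)
      fix y x
      assume "y \<in> cspace s - \<Union>A2" "x \<in> cspace r - \<Union>A1" "?g y = ?f x"
      then show "glue (r - p) r x y \<in> cspace (r + s - p) - \<Union>(parallel_arr r s p A1 X1 A2)"
        unfolding mem by (simp add: glue_in_cspace coords_glue_left coords_glue_right le)
    qed
  qed (auto simp: topspace_pullback_total coords_coords_eq[OF le, symmetric] glue_coords coords_glue_left
      coords_glue_right le)
  then show ?thesis
    using sq by (auto simp: is_pullback_bundle_def homeomorphic_map_maps)
qed

theorem theorem4p2:
  fixes E1 E2 F :: "'e set" and I1 I2 :: "'e set set"
    and r s p :: nat
    and A1 A2 :: "(nat \<Rightarrow> complex) set set"
    and h1 h2 :: "'e \<Rightarrow> (nat \<Rightarrow> complex) set"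
    and X1 X2 :: "(nat \<Rightarrow> complex) set"
  assumes "matroid E1 I1" and "matroid E2 I2"
    and "E1 \<inter> E2 = F"
    and "mflat E1 I1 F" and "mflat E2 I2 F"
    and "mrank I1 F = p" and "mrank I2 F = p"
    and "modular_flat E1 I1 F"
    and "realizes r A1 h1 E1 I1" and "realizes s A2 h2 E2 I2"
    and "p \<le> r" and "p \<le> s"
    and "X1 \<in> intersection_lattice r A1" and "localization A1 X1 = h1 ` F"
    and "X2 \<in> intersection_lattice s A2" and "localization A2 X2 = h2 ` F"
    and "X1 = {x \<in> cspace r. \<forall>i. r - p \<le> i \<and> i < r \<longrightarrow> x i = 0}"
    and "\<forall>e\<in>F. \<exists>a.
           h1 e = {x \<in> cspace r. lform p a (coords (r - p) p x) = 0} \<and>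
           h2 e = {x \<in> cspace s. lform p a (coords 0 p x) = 0}"
  shows "pullback_square TYPE('w)
           (arr_complement (r + s - p) (parallel_arr r s p A1 X1 A2))
           (arr_complement r A1)
           (arr_complement s A2)
           (arr_complement p (quotient_arr r p A1 X1))
           (coords 0 r) (coords (r - p) s) (coords (r - p) p) (coords 0 p) \<and>
         is_pullback_bundle
           (arr_complement (r + s - p) (parallel_arr r s p A1 X1 A2))
           (arr_complement r A1)
           (arr_complement s A2)
           (arr_complement p (quotient_arr r p A1 X1))
           (coords 0 r) (coords (r - p) s) (coords (r - p) p) (coords 0 p) \<and>
         (\<forall>\<Phi> :: 'f topology.
           fiber_bundle (arr_complement r A1) (arr_complement p (quotient_arr r p A1 X1))
             (coords (r - p) p) \<Phi> \<longrightarrow>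
           fiber_bundle (arr_complement (r + s - p) (parallel_arr r s p A1 X1 A2))
             (arr_complement s A2) (coords (r - p) s) \<Phi>)"
proof -
  have "bij_betw h2 E2 A2"
    using assms(10) by (simp add: realizes_def)
  then have h2: "h2 e \<in> A2" if "e \<in> F" for e
    using that assms(3) by (auto simp: bij_betw_def)
  \<comment> \<open>The matching of forms passes from labels to hyperplanes: a member of the
    localization is \<open>h1 e\<close> with \<open>e\<close> in \<open>F\<close>, and its
    counterpart \<open>h2 e\<close> belongs to \<open>A2\<close> because \<open>F\<close> lies in
    \<open>E2\<close>.\<close>
  have "\<forall>H\<in>localization A1 X1. \<exists>a.
       H = {x \<in> cspace r. lform p a (coords (r - p) p x) = 0} \<and>
       {x \<in> cspace s. lform p a (coords 0 p x) = 0} \<in> A2"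
  proof
    fix H assume "H \<in> localization A1 X1"
    then obtain e where e: "e \<in> F" "H = h1 e"
      using assms(14) by blast
    obtain a where "h1 e = {x \<in> cspace r. lform p a (coords (r - p) p x) = 0}"
      "h2 e = {x \<in> cspace s. lform p a (coords 0 p x) = 0}"
      using bspec[OF assms(18) e(1)] by blast
    then show "\<exists>a. H = {x \<in> cspace r. lform p a (coords (r - p) p x) = 0} \<and>
       {x \<in> cspace s. lform p a (coords 0 p x) = 0} \<in> A2"
      using h2[OF e(1)] e(2) by (intro exI[of _ a]) simp
  qed
  note pb = is_pullback_bundle_parallel_arr[OF assms(11,12) this]
  show ?thesis
    by (intro conjI allI impI pb is_pullback_bundle_imp_pullback_square[OF pb]
        fiber_bundle_pullback[OF pb])
qed

end
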